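(* Let $C$ and $D$ be two cycles in the graph $G$ with mutually disjoint interiors that have more than one vertex in common. Then there is a unique cycle $E$ satisfying the following properties: (i) $E=P_1\cup P_2$, where $P_1\subset D$ is a bridge for the cycle $C$ and $P_2\subset C$ is a bridge for the cycle $D$. (ii) The bridges $P_1$ and $P_2$ are unique, and the interiors of the cycles $C$ and $D$ lie in the interior of $E$.
   Context: Tile $\mathbb{R}^2$ into unit squares $\{S_k\}_{k\ge 0}$ (disjoint except for shared edges and corners), with the origin being the centre of $S_0$. $G$ is the graph whose vertices are the corners of the squares in $\{S_k\}$ and whose edges are the (unit length) edges of the squares in $\{S_k\}$. A cycle is a closed path of distinct edges without repeated vertices (a simple closed lattice polygon). A cycle divides the plane into a bounded region, its interior, and an unbounded region, its exterior. Bridges: let $P$ be a path of edges contained in the cycle $C$. $P\subset C$ is a bridge for $D$ if its endvertices lie in $D$ and every other vertex of $P$ lies in the exterior of $D$. Bridges $P\subset D$ for the cycle $C$ are defined in the same way with the roles of $C$ and $D$ interchanged. *)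

theory Defs
  imports "HOL-Analysis.Analysis"
begin

text \<open>
  The plane is the type \<^typ>\<open>complex\<close>, for which the library states the Jordan curve theorem.
  The squares of the tiling are indexed by their centres, the points of the integer lattice, so
  that the square with index \<open>(0, 0)\<close> is centred at the origin.
\<close>

definition square_corners :: "int \<times> int \<Rightarrow> complex set" where
  "square_corners k = (case k of (m, n) \<Rightarrow>
     {Complex (real_of_int m - 1/2) (real_of_int n - 1/2),
      Complex (real_of_int m + 1/2) (real_of_int n - 1/2),
      Complex (real_of_int m + 1/2) (real_of_int n + 1/2),
      Complex (real_of_int m - 1/2) (real_of_int n + 1/2)})"

text \<open>
  An edge is represented by the set of its two endvertices; two corners of a unit square at
  distance 1 are the endpoints of one of its sides. Every vertex of the graph is an endvertex of
  some edge.
\<close>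

definition lattice_edges :: "complex set set" where
  "lattice_edges =
     {{u, v} |u v. \<exists>k. u \<in> square_corners k \<and> v \<in> square_corners k \<and> dist u v = 1}"

definition edges_of :: "'a list \<Rightarrow> 'a set set" where
  "edges_of vs = {{vs ! i, vs ! Suc i} |i. Suc i < length vs}"

definition lattice_path :: "complex list \<Rightarrow> bool" where
  "lattice_path vs \<longleftrightarrow> 2 \<le> length vs \<and> distinct vs \<and> edges_of vs \<subseteq> lattice_edges"

text \<open>
  Cycles are edge sets, so that starting point and orientation are irrelevant. The vertex set of
  an edge set \<open>C\<close> is \<open>\<Union>C\<close>. Three or more distinct vertices make the edges distinct.
\<close>

definition lattice_cycle :: "complex set set \<Rightarrow> bool" where
  "lattice_cycle C \<longleftrightarrow>
     (\<exists>vs. 3 \<le> length vs \<and> distinct vs \<and> C = edges_of (vs @ [hd vs]) \<and> C \<subseteq> lattice_edges)"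

text \<open>The convex hull of an edge is the closed unit segment joining its endvertices.\<close>

definition curve :: "complex set set \<Rightarrow> complex set" where
  "curve C = (\<Union>e\<in>C. convex hull e)"

definition cycle_interior :: "complex set set \<Rightarrow> complex set" where
  "cycle_interior C = inside (curve C)"

definition cycle_exterior :: "complex set set \<Rightarrow> complex set" where
  "cycle_exterior C = outside (curve C)"

text \<open>
  \<open>bridge P C D\<close>: the edge set \<open>P \<subseteq> C\<close> is a bridge for \<open>D\<close>. If \<open>P\<close> is a single edge, only its
  endvertices are constrained.
\<close>

definition bridge :: "complex set set \<Rightarrow> complex set set \<Rightarrow> complex set set \<Rightarrow> bool" where
  "bridge P C D \<longleftrightarrow> P \<subseteq> C \<and>
     (\<exists>vs. lattice_path vs \<and> P = edges_of vs \<and> hd vs \<in> \<Union>D \<and> last vs \<in> \<Union>D \<and>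
        (\<forall>v \<in> set vs - {hd vs, last vs}. v \<in> cycle_exterior D))"

end

theory Submission
  imports Defs
begin

text \<open>
  Let \<open>U\<close> be the unbounded region of the complement of \<open>curve C \<union> curve D\<close>. A cycle \<open>E \<subseteq> C \<union> D\<close> whose
  interior contains those of \<open>C\<close> and \<open>D\<close> has \<open>U\<close> as its exterior, so its curve is the frontier of \<open>U\<close>
  (\<open>outside_enclosing_cycle\<close>). No edge of \<open>E\<close> belongs to both \<open>C\<close> and \<open>D\<close>, because on the two sides of
  a common edge lie the interiors of \<open>C\<close> and \<open>D\<close> (\<open>enclosing_cycle_avoids_common_edges\<close>). Hence \<open>E\<close>,
  \<open>P1 = E \<inter> D\<close> and \<open>P2 = E \<inter> C\<close> are unique.

  For existence, the frontier of \<open>U\<close> contains an interior point of an edge \<open>e\<close> of \<open>D\<close> that is not on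
  \<open>C\<close> (\<open>outer_boundary_point\<close>). Let \<open>P1\<close> be the bridge of \<open>D\<close> through \<open>e\<close>, with ends \<open>a\<close> and \<open>b\<close>, which
  cut \<open>C\<close> into paths \<open>A\<close> and \<open>A'\<close>. Since \<open>P1\<close> borders on \<open>U\<close>, one of these paths, say \<open>A'\<close>, lies inside
  the cycle formed by \<open>P1\<close> and the other (\<open>theta_third_arc_inside\<close>). Then \<open>A'\<close> divides the interior of
  \<open>E = P1 \<union> A\<close> into the interior of \<open>C\<close> and that of \<open>P1 \<union> A'\<close>. The interior of \<open>D\<close> lies next to \<open>e\<close> on
  the side opposite to \<open>U\<close>, and it meets neither \<open>P1\<close> nor \<open>C\<close> nor the interior of \<open>C\<close>, so it is contained
  in the interior of \<open>P1 \<union> A'\<close>. Therefore \<open>D\<close> touches \<open>A\<close> in \<open>a\<close> and \<open>b\<close> only, and \<open>P2 = A\<close> is a bridge for \<open>D\<close>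
  (\<open>theta_outer_cycle\<close>).

  The topological input is the Jordan curve theorem, the theta curve theorem, and the remark that a
  segment has just two sides (\<open>no_three_regions_at_segment\<close>).
\<close>

section \<open>Lattice edges and the curves they trace\<close>

text \<open>
  Two corners of a square that are opposite are at distance \<open>sqrt 2\<close>, so only the four sides
  survive. The normal form by integer coordinates of the lower left end reduces statements about
  edges to integer inequalities.
\<close>

lemma lattice_edgeE:
  assumes "e \<in> lattice_edges"
  obtains (horizontal) m n :: int
      where "e = {Complex (m + 1/2) (n + 1/2), Complex (m + 1 + 1/2) (n + 1/2)}"
    | (vertical) m n :: int
      where "e = {Complex (m + 1/2) (n + 1/2), Complex (m + 1/2) (n + 1 + 1/2)}"
proof -
  obtain u v m n where e: "e = {u, v}" and uv: "u \<in> square_corners (m, n)" "v \<in> square_corners (m, n)"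
    and d: "dist u v = 1"
    using assms unfolding lattice_edges_def by auto
  let ?l = "real_of_int m - 1/2" and ?r = "real_of_int m + 1/2"
    and ?b = "real_of_int n - 1/2" and ?t = "real_of_int n + 1/2"
  have dist: "dist (Complex a b) (Complex c d) = 1 \<longleftrightarrow> (a - c)\<^sup>2 + (b - d)\<^sup>2 = 1" for a b c d
    by (simp add: dist_norm cmod_def)
  have "u = Complex ?l ?b \<or> u = Complex ?r ?b \<or> u = Complex ?r ?t \<or> u = Complex ?l ?t"
    "v = Complex ?l ?b \<or> v = Complex ?r ?b \<or> v = Complex ?r ?t \<or> v = Complex ?l ?t"
    using uv unfolding square_corners_def by auto
  then have "{u, v} = {Complex ?l ?b, Complex ?r ?b} \<or> {u, v} = {Complex ?l ?t, Complex ?r ?t} \<or>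
             {u, v} = {Complex ?l ?b, Complex ?l ?t} \<or> {u, v} = {Complex ?r ?b, Complex ?r ?t}"
    using d by (elim disjE; hypsubst) (simp_all add: dist insert_commute)
  then consider "e = {Complex ?l ?b, Complex ?r ?b}" | "e = {Complex ?l ?t, Complex ?r ?t}"
    | "e = {Complex ?l ?b, Complex ?l ?t}" | "e = {Complex ?r ?b, Complex ?r ?t}"
    unfolding e by argo
  moreover have eqs: "real_of_int (m - 1) + 1/2 = ?l" "real_of_int (m - 1 + 1) + 1/2 = ?r"
    "real_of_int (n - 1) + 1/2 = ?b" "real_of_int (n - 1 + 1) + 1/2 = ?t"
    by auto
  ultimately show thesis
    using horizontal [of "m - 1" "n - 1"] horizontal [of "m - 1" n]
      vertical [of "m - 1" "n - 1"] vertical [of m "n - 1"]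
    unfolding eqs by cases
qed

lemma lattice_edge_segment:
  assumes "e \<in> lattice_edges"
  obtains u v where "e = {u, v}" "u \<noteq> v" "convex hull e = closed_segment u v"
  using assms by (cases rule: lattice_edgeE) (auto simp: segment_convex_hull)

text \<open>
  The interior of a horizontal edge lies on a half-integral height, at an abscissa strictly between
  two consecutive half-integers, and symmetrically for vertical edges. So a point common to two
  different edges has both coordinates half-integral, and on an edge only the two ends are such points.
\<close>

lemma lattice_edges_meet:
  assumes "e \<in> lattice_edges" "f \<in> lattice_edges" "e \<noteq> f" "z \<in> convex hull e" "z \<in> convex hull f"
  shows "z \<in> e" "z \<in> f"
proof -
  have H: "convex hull {Complex (m + 1/2) (n + 1/2), Complex (m + 1 + 1/2) (n + 1/2)} =
     {z. Im z = n + 1/2 \<and> m + 1/2 \<le> Re z \<and> Re z \<le> m + 1 + 1/2}" for m n :: int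
    by (subst segment_convex_hull [symmetric], subst closed_segment_same_Im) (auto simp: closed_segment_eq_real_ivl)
  have V: "convex hull {Complex (m + 1/2) (n + 1/2), Complex (m + 1/2) (n + 1 + 1/2)} =
     {z. Re z = m + 1/2 \<and> n + 1/2 \<le> Im z \<and> Im z \<le> n + 1 + 1/2}" for m n :: int
    by (subst segment_convex_hull [symmetric], subst closed_segment_same_Re) (auto simp: closed_segment_eq_real_ivl)
  have *: "z \<in> e \<and> z \<in> f"
    using assms(1)
  proof (cases rule: lattice_edgeE)
    case (horizontal m n)
    note e = this
    show ?thesis using assms(2)
    proof (cases rule: lattice_edgeE)
      case (horizontal m' n')
      have z: "Im z = n + 1/2" "m + 1/2 \<le> Re z" "Re z \<le> m + 1 + 1/2"
        "Im z = n' + 1/2" "m' + 1/2 \<le> Re z" "Re z \<le> m' + 1 + 1/2"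
        using assms(4,5) unfolding e horizontal H by auto
      then have "n = n'" "m' \<le> m + 1" "m \<le> m' + 1" by linarith+
      moreover from this have "m \<noteq> m'" using assms(3) e horizontal by auto
      ultimately have "n = n' \<and> (m' = m + 1 \<or> m = m' + 1)" by linarith
      with z show ?thesis unfolding e horizontal by (auto simp: complex_eq_iff)
    next
      case (vertical m' n')
      have z: "Im z = n + 1/2" "m + 1/2 \<le> Re z" "Re z \<le> m + 1 + 1/2"
        "Re z = m' + 1/2" "n' + 1/2 \<le> Im z" "Im z \<le> n' + 1 + 1/2"
        using assms(4,5) unfolding e vertical H V by auto
      then have "n' \<le> n" "n \<le> n' + 1" "m \<le> m'" "m' \<le> m + 1" by linarith+
      then have "(n = n' \<or> n = n' + 1) \<and> (m' = m \<or> m' = m + 1)" by linarith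
      with z show ?thesis unfolding e vertical by (auto simp: complex_eq_iff)
    qed
  next
    case (vertical m n)
    note e = this
    show ?thesis using assms(2)
    proof (cases rule: lattice_edgeE)
      case (vertical m' n')
      have z: "Re z = m + 1/2" "n + 1/2 \<le> Im z" "Im z \<le> n + 1 + 1/2"
        "Re z = m' + 1/2" "n' + 1/2 \<le> Im z" "Im z \<le> n' + 1 + 1/2"
        using assms(4,5) unfolding e vertical V by auto
      then have "m = m'" "n' \<le> n + 1" "n \<le> n' + 1" by linarith+
      moreover from this have "n \<noteq> n'" using assms(3) e vertical by auto
      ultimately have "m = m' \<and> (n' = n + 1 \<or> n = n' + 1)" by linarith
      with z show ?thesis unfolding e vertical by (auto simp: complex_eq_iff)
    next
      case (horizontal m' n')
      have z: "Re z = m + 1/2" "n + 1/2 \<le> Im z" "Im z \<le> n + 1 + 1/2"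
        "Im z = n' + 1/2" "m' + 1/2 \<le> Re z" "Re z \<le> m' + 1 + 1/2"
        using assms(4,5) unfolding e horizontal H V by auto
      then have "n \<le> n'" "n' \<le> n + 1" "m' \<le> m" "m \<le> m' + 1" by linarith+
      then have "(n' = n \<or> n' = n + 1) \<and> (m = m' \<or> m = m' + 1)" by linarith
      with z show ?thesis unfolding e horizontal by (auto simp: complex_eq_iff)
    qed
  qed
  then show "z \<in> e" "z \<in> f" by auto
qed

lemma vertex_in_edge:
  assumes "F \<subseteq> lattice_edges" "x \<in> \<Union>F" "e \<in> lattice_edges" "x \<in> convex hull e"
  shows "x \<in> e"
  using assms lattice_edges_meet(2) by (metis Union_iff hull_inc subsetD)

lemma curve_Un: "curve (F \<union> G) = curve F \<union> curve G"
  by (simp add: curve_def)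

lemma curve_mono: "F \<subseteq> G \<Longrightarrow> curve F \<subseteq> curve G"
  by (auto simp: curve_def)

lemma vertices_subset_curve: "\<Union>F \<subseteq> curve F"
  by (auto simp: curve_def intro: hull_inc)

lemma curve_vertex:
  assumes "F \<subseteq> lattice_edges" "G \<subseteq> lattice_edges" "x \<in> \<Union>F" "x \<in> curve G"
  shows "x \<in> \<Union>G"
  using assms vertex_in_edge unfolding curve_def by blast

text \<open>
  This is how intersections of curves become a matter of vertices: without a common edge, two curves
  can meet only where two different edges meet.
\<close>

lemma curve_Int:
  assumes "F \<subseteq> lattice_edges" "G \<subseteq> lattice_edges" "F \<inter> G = {}"
  shows "curve F \<inter> curve G = \<Union>F \<inter> \<Union>G"
proof
  show "curve F \<inter> curve G \<subseteq> \<Union>F \<inter> \<Union>G"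
    using assms lattice_edges_meet unfolding curve_def by blast
  show "\<Union>F \<inter> \<Union>G \<subseteq> curve F \<inter> curve G"
    using vertices_subset_curve by blast
qed

text \<open>
  The midpoint of an edge lies on no other edge, so the point set \<open>curve F\<close> remembers \<open>F\<close>.
\<close>

lemma curve_subset_imp_subset:
  assumes "F \<subseteq> lattice_edges" "G \<subseteq> lattice_edges" "curve F \<subseteq> curve G"
  shows "F \<subseteq> G"
proof
  fix e assume e: "e \<in> F"
  then obtain u v where uv: "e = {u, v}" "u \<noteq> v" "convex hull e = closed_segment u v"
    using assms lattice_edge_segment by blast
  have "midpoint u v \<in> convex hull e" "midpoint u v \<notin> e"
    using uv by (auto simp: midpoint_eq_endpoint)
  moreover from this e obtain f where "f \<in> G" "midpoint u v \<in> convex hull f"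
    using assms unfolding curve_def by blast
  ultimately show "e \<in> G"
    using lattice_edges_meet(1) e assms by blast
qed

lemma closed_curve: "finite F \<Longrightarrow> F \<subseteq> lattice_edges \<Longrightarrow> closed (curve F)"
  unfolding curve_def
  by (intro closed_UN) (metis closed_segment lattice_edge_segment subsetD)+

section \<open>Vertex lists of paths and cycles\<close>

lemma edges_of_simps [simp]:
  "edges_of [] = {}" "edges_of [x] = {}"
  "edges_of (x # y # zs) = insert {x, y} (edges_of (y # zs))"
proof -
  show "edges_of (x # y # zs) = insert {x, y} (edges_of (y # zs))"
  proof (intro set_eqI iffI)
    fix e assume "e \<in> edges_of (x # y # zs)"
    then obtain i where "Suc i < length (x # y # zs)" "e = {(x # y # zs) ! i, (x # y # zs) ! Suc i}"
      unfolding edges_of_def by auto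
    then show "e \<in> insert {x, y} (edges_of (y # zs))"
      by (cases i) (auto simp: edges_of_def)
  next
    fix e assume "e \<in> insert {x, y} (edges_of (y # zs))"
    then consider "e = {x, y}" | i where "Suc i < length (y # zs)" "e = {(y # zs) ! i, (y # zs) ! Suc i}"
      unfolding edges_of_def by auto
    then show "e \<in> edges_of (x # y # zs)"
    proof cases
      case 1
      then show ?thesis unfolding edges_of_def by (auto intro!: exI [of _ 0])
    next
      case 2
      then show ?thesis unfolding edges_of_def by (auto intro!: exI [of _ "Suc i"])
    qed
  qed
qed (auto simp: edges_of_def)

lemma edges_of_append: "edges_of (xs @ y # zs) = edges_of (xs @ [y]) \<union> edges_of (y # zs)"
proof (induction xs)
  case (Cons x xs)
  then show ?case by (cases xs) auto
qed simp

lemma finite_edges_of [simp]: "finite (edges_of vs)"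
  by (induction vs rule: induct_list012) auto

lemma Union_edges_of: "2 \<le> length vs \<Longrightarrow> \<Union>(edges_of vs) = set vs"
proof (induction vs rule: induct_list012)
  case (3 x y zs)
  then show ?case by (cases zs) auto
qed auto

lemma edges_of_split: "2 \<le> length ys \<Longrightarrow> e \<in> edges_of ys \<Longrightarrow> \<exists>us x y vs. ys = us @ x # y # vs \<and> e = {x, y}"
proof (induction ys rule: induct_list012)
  case (3 x y zs)
  show ?case
  proof (cases "e = {x, y}")
    case True
    then show ?thesis by (intro exI [of _ "[]"]) auto
  next
    case False
    then have "e \<in> edges_of (y # zs)" using 3 by auto
    then have "\<exists>us x' y' vs. y # zs = us @ x' # y' # vs \<and> e = {x', y'}"
      using 3 by (cases zs) auto
    then show ?thesis by (metis append_Cons)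
  qed
qed auto

text \<open>
  In a path whose vertices are distinct, each end lies on a single edge, so an edge joining the two
  ends is the whole path.
\<close>

lemma edge_joining_ends:
  assumes "distinct (b # zs @ [a])" "{a, b} \<in> edges_of (b # zs @ [a])"
  shows "zs = []"
proof (cases zs)
  case (Cons z zs')
  have "\<Union>(edges_of (z # zs' @ [a])) = set (z # zs' @ [a])"
    by (rule Union_edges_of) simp
  then have "{a, b} \<notin> edges_of (z # zs' @ [a])"
    using assms(1) Cons by auto
  then show ?thesis
    using assms Cons by (auto simp: doubleton_eq_iff)
qed simp

lemma edges_of_rotate:
  assumes "xs \<noteq> []" "ys \<noteq> []"
  shows "edges_of (xs @ ys @ [hd xs]) = edges_of (ys @ xs @ [hd ys])"
proof -
  obtain x xs' y ys' where "xs = x # xs'" "ys = y # ys'"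
    using assms by (meson list.exhaust)
  then show ?thesis
    using edges_of_append [of "x # xs'" y "ys' @ [x]"] edges_of_append [of "y # ys'" x "xs' @ [y]"]
    by auto
qed

lemma lattice_cycle_split:
  assumes "distinct vs" "a \<in> set vs" "b \<in> set vs" "a \<noteq> b"
  obtains xs ys where "distinct (a # xs @ b # ys)"
    "length vs = length (a # xs @ b # ys)"
    "edges_of (vs @ [hd vs]) = edges_of (a # xs @ [b]) \<union> edges_of (b # ys @ [a])"
proof -
  obtain us ws where vs: "vs = us @ a # ws"
    using assms(2) by (meson split_list)
  have rot: "edges_of (vs @ [hd vs]) = edges_of ((a # ws @ us) @ [a])"
    using edges_of_rotate [of us "a # ws"] vs by (cases us) auto
  have "b \<in> set (ws @ us)" using assms vs by auto
  then obtain xs ys where xy: "ws @ us = xs @ b # ys" by (meson split_list)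
  show thesis
  proof
    have "mset vs = mset (a # xs @ b # ys)"
      using vs arg_cong [OF xy, of mset] by (simp add: union_commute)
    then show "length vs = length (a # xs @ b # ys)" "distinct (a # xs @ b # ys)"
      using assms(1) mset_eq_length mset_eq_imp_distinct_iff by blast+
    show "edges_of (vs @ [hd vs]) = edges_of (a # xs @ [b]) \<union> edges_of (b # ys @ [a])"
      using rot edges_of_append [of "a # xs" b "ys @ [a]"] xy by auto
  qed
qed

text \<open>
  For \<open>V\<close> the vertex set of another cycle, \<open>b # zs @ [a]\<close> is the bridge containing \<open>e\<close>: if the cycle
  is listed so that \<open>e\<close> joins its last vertex to its first, then \<open>a\<close> is the first and \<open>b\<close> the last
  vertex of \<open>V\<close>, and the piece runs from \<open>b\<close> across \<open>e\<close> to \<open>a\<close>. Two vertices in \<open>V\<close> ensure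
  \<open>a \<noteq> b\<close>.
\<close>

lemma cycle_piece_containing_edge:
  assumes "2 \<le> length vs" "distinct vs" "e \<in> edges_of (vs @ [hd vs])"
    and "u \<in> V" "w \<in> V" "u \<in> set vs" "w \<in> set vs" "u \<noteq> w"
  obtains a zs b ys where "distinct (b # zs @ a # ys)" "a \<in> V" "b \<in> V" "set zs \<inter> V = {}"
    "e \<in> edges_of (b # zs @ [a])"
    "edges_of (vs @ [hd vs]) = edges_of (b # zs @ [a]) \<union> edges_of (a # ys @ [b])"
proof -
  \<comment> \<open>rotate so that the edge closes up the cycle\<close>
  obtain ts where ts: "mset ts = mset vs" "2 \<le> length ts" "e = {last ts, hd ts}"
    "edges_of (vs @ [hd vs]) = edges_of (ts @ [hd ts])"
  proof -
    obtain us x y ws where s: "vs @ [hd vs] = us @ x # y # ws" "e = {x, y}"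
      using edges_of_split [of "vs @ [hd vs]" e] assms by auto
    show thesis
    proof (cases ws rule: rev_cases)
      case Nil
      then have "vs = us @ [x]" "y = hd vs" using s by auto
      then show thesis using that [of vs] s assms by auto
    next
      case (snoc ws' l)
      then have vs: "vs = (us @ [x]) @ (y # ws')" using s by auto
      moreover have "edges_of (vs @ [hd vs]) = edges_of (((y # ws') @ (us @ [x])) @ [y])"
        using edges_of_rotate [of "us @ [x]" "y # ws'"] vs by (cases us) auto
      ultimately show thesis
        using that [of "(y # ws') @ (us @ [x])"] s by (simp add: insert_commute)
    qed
  qed
  have set: "set ts = set vs" "distinct ts"
    using ts assms mset_eq_setD mset_eq_imp_distinct_iff by blast+
  obtain xs a rest where a: "ts = xs @ a # rest" "a \<in> V" "set xs \<inter> V = {}"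
    using split_list_first_prop [of ts "\<lambda>x. x \<in> V"] set assms by (metis disjoint_iff)
  have "set vs = set xs \<union> {a} \<union> set rest" using a set by auto
  then have "\<exists>x\<in>set rest. x \<in> V" using a assms by blast
  then obtain ys b zs where b: "rest = ys @ b # zs" "b \<in> V" "set zs \<inter> V = {}"
    using split_list_last_prop [of rest "\<lambda>x. x \<in> V"] by (metis disjoint_iff)
  have rot: "edges_of (ts @ [hd ts]) = edges_of (((b # zs) @ xs @ a # ys) @ [b])"
    using edges_of_rotate [of "xs @ a # ys" "b # zs"] a b by (auto simp: hd_append)
  show thesis
  proof
    show "distinct (b # (zs @ xs) @ a # ys)"
      using set a b by auto
    show "a \<in> V" "b \<in> V" "set (zs @ xs) \<inter> V = {}" using a b by auto
    show "edges_of (vs @ [hd vs]) = edges_of (b # (zs @ xs) @ [a]) \<union> edges_of (a # ys @ [b])"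
      using rot ts edges_of_append [of "b # zs @ xs" a "ys @ [b]"] by auto
    have "last ts = last (b # zs)" "hd ts = hd (xs @ [a])" using a b by (auto simp: hd_append)
    moreover obtain zs' l where "b # zs = zs' @ [l]"
      by (metis append_butlast_last_id list.distinct(1))
    moreover have "{l, hd (xs @ [a])} \<in> edges_of (zs' @ l # xs @ [a])" for l zs'
      using edges_of_append [of zs' l "xs @ [a]"] by (cases xs) auto
    ultimately have "{last ts, hd ts} \<in> edges_of ((b # zs) @ xs @ [a])"
      by (metis append.assoc append_Cons append_Nil last_snoc)
    then show "e \<in> edges_of (b # (zs @ xs) @ [a])" using ts by auto
  qed
qed

lemma hd_noteq_last: "lattice_path vs \<Longrightarrow> hd vs \<noteq> last vs"
  unfolding lattice_path_def by (cases vs) auto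

lemma lattice_path_shape:
  assumes "lattice_path vs"
  obtains xs where "vs = hd vs # xs @ [last vs]"
proof -
  obtain x l where "vs = x # l" "l \<noteq> []"
    using assms unfolding lattice_path_def by (cases vs; cases "tl vs") auto
  then show thesis using that [of "butlast l"] by auto
qed

lemma edges_of_rev: "edges_of (rev vs) = edges_of vs"
proof (induction vs rule: induct_list012)
  case (3 x y zs)
  then show ?case using edges_of_append [of "rev zs" y "[x]"] by (auto simp: insert_commute)
qed auto

lemma vertices_lattice_path: "lattice_path vs \<Longrightarrow> \<Union>(edges_of vs) = set vs"
  by (simp add: lattice_path_def Union_edges_of)

text \<open>
  Two vertices cut a cycle into two paths, here both oriented from \<open>a\<close> to \<open>b\<close>, the form in which
  three arcs make a theta curve. The two paths share no edge: it would join \<open>a\<close> and \<open>b\<close> and be all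
  of both paths, whereas a cycle has at least three vertices.
\<close>

lemma lattice_cycle_two_paths:
  assumes "lattice_cycle C" "a \<in> \<Union>C" "b \<in> \<Union>C" "a \<noteq> b"
  obtains P Q where "lattice_path P" "lattice_path Q" "hd P = a" "last P = b" "hd Q = a" "last Q = b"
    "C = edges_of P \<union> edges_of Q" "edges_of P \<inter> edges_of Q = {}" "set P \<inter> set Q = {a, b}"
proof -
  obtain vs where vs: "3 \<le> length vs" "distinct vs" "C = edges_of (vs @ [hd vs])" "C \<subseteq> lattice_edges"
    using assms(1) unfolding lattice_cycle_def by blast
  have "\<Union>C = set vs"
    using vs Union_edges_of [of "vs @ [hd vs]"] by (cases vs) auto
  then obtain xs ys where xy: "distinct (a # xs @ b # ys)" "length vs = length (a # xs @ b # ys)"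
    "C = edges_of (a # xs @ [b]) \<union> edges_of (b # ys @ [a])"
    using lattice_cycle_split [of vs a b] vs assms by metis
  let ?P = "a # xs @ [b]" and ?Q = "rev (b # ys @ [a])"
  have Q: "edges_of ?Q = edges_of (b # ys @ [a])" by (rule edges_of_rev)
  have l: "lattice_path ?P" "lattice_path ?Q"
    using xy vs unfolding lattice_path_def Q by auto
  have int: "set ?P \<inter> set ?Q = {a, b}" using xy by auto
  have "edges_of ?P \<inter> edges_of ?Q = {}"
  proof (rule ccontr)
    assume "edges_of ?P \<inter> edges_of ?Q \<noteq> {}"
    then obtain f where f: "f \<in> edges_of ?P" "f \<in> edges_of (b # ys @ [a])" using Q by auto
    then have "f \<subseteq> {a, b}" using l int vertices_lattice_path Q by blast
    moreover have "f \<in> lattice_edges" using f l unfolding lattice_path_def by auto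
    ultimately have "f = {a, b}" by (auto elim!: lattice_edge_segment)
    then have "xs = []" "ys = []"
      using edge_joining_ends [of a xs b] edge_joining_ends [of b ys a] f xy by (auto simp: insert_commute)
    then show False using xy vs by auto
  qed
  with that [of ?P ?Q] l int xy Q show thesis by auto
qed

lemma lattice_cycle_of_two_paths:
  assumes P: "lattice_path P" "hd P = a" "last P = b" and Q: "lattice_path Q" "hd Q = a" "last Q = b"
    and int: "set P \<inter> set Q = {a, b}" and disj: "edges_of P \<inter> edges_of Q = {}"
  shows "lattice_cycle (edges_of P \<union> edges_of Q)"
proof -
  obtain xs ys where xy: "P = a # xs @ [b]" "Q = a # ys @ [b]"
    using lattice_path_shape P Q by metis
  have "edges_of ((a # xs @ b # rev ys) @ [a]) = edges_of P \<union> edges_of (b # rev ys @ [a])"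
    using edges_of_append [of "a # xs" b "rev ys @ [a]"] xy by simp
  moreover have "edges_of (b # rev ys @ [a]) = edges_of Q"
    using edges_of_rev [of Q] xy by simp
  moreover have "distinct (a # xs @ b # rev ys)"
    using P(1) Q(1) int unfolding lattice_path_def xy by auto
  moreover have "xs \<noteq> [] \<or> ys \<noteq> []" using disj xy by auto
  then have "3 \<le> length (a # xs @ b # rev ys)" by (cases xs; cases ys) auto
  ultimately show ?thesis
    using P(1) Q(1) unfolding lattice_cycle_def lattice_path_def
    by (intro exI [of _ "a # xs @ b # rev ys"]) auto
qed

lemma lattice_cycle_path_through_edge:
  assumes "lattice_cycle D" "e \<in> D" "u \<in> V \<inter> \<Union>D" "w \<in> V \<inter> \<Union>D" "u \<noteq> w"
  obtains B a b where "lattice_path B" "hd B = a" "last B = b" "e \<in> edges_of B" "edges_of B \<subseteq> D"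
    "set B \<inter> V = {a, b}"
proof -
  obtain vs where vs: "3 \<le> length vs" "distinct vs" "D = edges_of (vs @ [hd vs])" "D \<subseteq> lattice_edges"
    using assms(1) unfolding lattice_cycle_def by blast
  have "\<Union>D = set vs"
    using vs Union_edges_of [of "vs @ [hd vs]"] by (cases vs) auto
  then have "2 \<le> length vs" "distinct vs" "e \<in> edges_of (vs @ [hd vs])"
    "u \<in> V" "w \<in> V" "u \<in> set vs" "w \<in> set vs" "u \<noteq> w"
    using vs assms by auto
  then obtain a zs b ys where B: "distinct (b # zs @ a # ys)" "a \<in> V" "b \<in> V" "set zs \<inter> V = {}"
    "e \<in> edges_of (b # zs @ [a])" "D = edges_of (b # zs @ [a]) \<union> edges_of (a # ys @ [b])"
    unfolding vs(3) by (rule cycle_piece_containing_edge)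
  show thesis
    using B vs that [of "b # zs @ [a]" b a] unfolding lattice_path_def by auto
qed

section \<open>Lattice paths as arcs and lattice cycles as Jordan curves\<close>

text \<open>
  Prepending a vertex adds one segment, which meets the rest only in its end, because the new vertex
  does not occur again.
\<close>

lemma arc_lattice_path:
  assumes "lattice_path vs"
  obtains g where "arc g" "pathstart g = hd vs" "pathfinish g = last vs" "path_image g = curve (edges_of vs)"
proof -
  have "2 \<le> length vs \<Longrightarrow> distinct vs \<Longrightarrow> edges_of vs \<subseteq> lattice_edges \<Longrightarrow>
    \<exists>g. arc g \<and> pathstart g = hd vs \<and> pathfinish g = last vs \<and> path_image g = curve (edges_of vs)"
  proof (induction vs rule: induct_list012)
    case (3 x y zs)
    have e: "path_image (linepath x y) = curve {{x, y}}" "arc (linepath x y)"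
      using 3 by (auto simp: curve_def segment_convex_hull)
    show ?case
    proof (cases zs)
      case Nil
      with e show ?thesis by (intro exI [of _ "linepath x y"]) auto
    next
      case (Cons z zs')
      then obtain g where g: "arc g" "pathstart g = y" "pathfinish g = last (y # zs)"
        "path_image g = curve (edges_of (y # zs))"
        using 3 by auto
      have V: "\<Union>(edges_of (y # zs)) = set (y # zs)"
        using Cons by (intro Union_edges_of) auto
      then have "{x, y} \<notin> edges_of (y # zs)" using 3 by auto
      then have "path_image (linepath x y) \<inter> path_image g = \<Union>{{x, y}} \<inter> set (y # zs)"
        using 3 V unfolding e g by (subst curve_Int) auto
      then have sub: "path_image (linepath x y) \<inter> path_image g \<subseteq> {pathstart g}"
        using 3 g by auto
      have "arc (linepath x y +++ g)"
        using e g sub by (intro arc_join) auto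
      moreover have "path_image (linepath x y +++ g) = curve (edges_of (x # y # zs))"
        using g e curve_Un [of "{{x, y}}" "edges_of (y # zs)"] by (simp add: path_image_join)
      ultimately show ?thesis
        using g by (intro exI [of _ "linepath x y +++ g"]) auto
    qed
  qed auto
  then show thesis using assms that unfolding lattice_path_def by auto
qed

lemma lattice_cycle_edges: "lattice_cycle C \<Longrightarrow> C \<subseteq> lattice_edges \<and> finite C"
  unfolding lattice_cycle_def by auto

lemma inside_closed_path:
  fixes c :: "real \<Rightarrow> complex"
  assumes "simple_path c" "pathfinish c = pathstart c"
  shows "inside (path_image c) \<noteq> {}" "open (inside (path_image c))" "connected (inside (path_image c))"
    "frontier (inside (path_image c)) = path_image c" "frontier (outside (path_image c)) = path_image c"
    "closure (inside (path_image c)) = inside (path_image c) \<union> path_image c"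
proof -
  note J = Jordan_inside_outside [OF assms]
  show "inside (path_image c) \<noteq> {}" "open (inside (path_image c))" "connected (inside (path_image c))"
    "frontier (inside (path_image c)) = path_image c" "frontier (outside (path_image c)) = path_image c"
    using J by simp_all
  then show "closure (inside (path_image c)) = inside (path_image c) \<union> path_image c"
    using closure_Un_frontier by metis
qed

lemma simple_closed_path_lattice_cycle:
  assumes "lattice_cycle C"
  obtains g where "simple_path g" "pathfinish g = pathstart g" "path_image g = curve C"
proof -
  obtain vs where vs: "3 \<le> length vs" "distinct vs" "C = edges_of (vs @ [hd vs])"
    using assms unfolding lattice_cycle_def by blast
  then have "\<Union>C = set vs"
    using Union_edges_of [of "vs @ [hd vs]"] by (cases vs) auto
  moreover have "hd vs \<noteq> last vs" "hd vs \<in> set vs" "last vs \<in> set vs"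
    using vs by (cases vs; auto)+
  ultimately obtain P Q where PQ: "lattice_path P" "lattice_path Q" "hd P = hd vs" "last P = last vs"
    "hd Q = hd vs" "last Q = last vs"
    "C = edges_of P \<union> edges_of Q" "edges_of P \<inter> edges_of Q = {}" "set P \<inter> set Q = {hd vs, last vs}"
    using lattice_cycle_two_paths [OF assms, of "hd vs" "last vs"] by metis
  obtain g h where g: "arc g" "pathstart g = hd P" "pathfinish g = last P" "path_image g = curve (edges_of P)"
    and h: "arc h" "pathstart h = hd Q" "pathfinish h = last Q" "path_image h = curve (edges_of Q)"
    using PQ arc_lattice_path by metis
  have "path_image g \<inter> path_image h = {hd vs, last vs}"
    using PQ vertices_lattice_path unfolding g h lattice_path_def by (subst curve_Int) auto
  then have "simple_path (g +++ reversepath h)"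
    using g h PQ by (intro simple_path_join_loop) (auto simp: arc_reversepath)
  then show thesis
    using that [of "g +++ reversepath h"] g h PQ by (simp add: path_image_join curve_Un)
qed

lemma bounded_curve: "finite F \<Longrightarrow> F \<subseteq> lattice_edges \<Longrightarrow> bounded (curve F)"
  unfolding curve_def
  by (rule bounded_UN) (auto intro!: bounded_convex_hull elim!: lattice_edge_segment)

lemma inside_lattice_cycle:
  assumes "lattice_cycle C"
  shows "inside (curve C) \<noteq> {}" "open (inside (curve C))" "connected (inside (curve C))"
    "frontier (inside (curve C)) = curve C" "frontier (outside (curve C)) = curve C"
    "closure (inside (curve C)) = inside (curve C) \<union> curve C"
proof -
  obtain g where g: "simple_path g" "pathfinish g = pathstart g" "path_image g = curve C"
    using assms simple_closed_path_lattice_cycle by blast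
  show "inside (curve C) \<noteq> {}" "open (inside (curve C))" "connected (inside (curve C))"
    "frontier (inside (curve C)) = curve C" "frontier (outside (curve C)) = curve C"
    "closure (inside (curve C)) = inside (curve C) \<union> curve C"
    using inside_closed_path [OF g(1,2)] unfolding g(3) by simp_all
qed

section \<open>The two sides of a segment\<close>

lemma connected_misses_frontier_subset:
  assumes "connected S" "S \<inter> W \<noteq> {}" "S \<inter> frontier W = {}"
  shows "S \<subseteq> W"
  using assms connected_Int_frontier by blast

text \<open>
  In the coordinate \<open>q = (z - p) / (v - u)\<close> the segment is a piece of the real axis around \<open>0\<close>, and the
  sides are the two halves of a small disc.
\<close>

lemma segment_two_sides:
  fixes p u v :: complex
  assumes p: "p \<in> open_segment u v" and K: "closed K" "p \<notin> K"
  obtains H1 H2 N where "connected H1" "connected H2" "H1 \<noteq> {}" "H2 \<noteq> {}" "open N" "p \<in> N"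
    "N \<subseteq> H1 \<union> H2 \<union> closed_segment u v" "(H1 \<union> H2) \<inter> (closed_segment u v \<union> K) = {}"
proof -
  define w where "w = v - u"
  obtain t where uv: "u \<noteq> v" and t: "0 < t" "t < 1" and pt: "p = (1 - t) *\<^sub>R u + t *\<^sub>R v"
    using p unfolding in_segment by blast
  have w: "w \<noteq> 0" using uv by (simp add: w_def)
  have pu: "p = u + of_real t * w" using pt by (simp add: w_def algebra_simps scaleR_conv_of_real)
  obtain \<delta> where \<delta>: "\<delta> > 0" "ball p \<delta> \<inter> K = {}"
    using K by (metis ComplI openE open_Compl disjoint_eq_subset_Compl)
  define r where "r = min (min t (1 - t)) (\<delta> / norm w)"
  have r: "0 < r" "r \<le> t" "r \<le> 1 - t" "r \<le> \<delta> / norm w"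
    using t \<delta> w by (auto simp: r_def)
  then have r\<delta>: "r * norm w \<le> \<delta>" using w by (simp add: pos_le_divide_eq)
  define f where "f = (\<lambda>q. p + q * w)"
  have inK: "f q \<notin> K" if "norm q < r" for q
  proof -
    have "norm (q * w) < r * norm w" using that w by (simp add: norm_mult)
    then have "f q \<in> ball p \<delta>" using r\<delta> by (simp add: f_def dist_norm)
    then show ?thesis using \<delta> by blast
  qed
  have seg: "f q \<in> closed_segment u v \<longleftrightarrow> Im q = 0" if "norm q < r" for q
  proof
    assume "f q \<in> closed_segment u v"
    then obtain s where "f q = u + of_real s * w"
      unfolding in_segment by (auto simp: w_def algebra_simps scaleR_conv_of_real)
    then have "q * w = of_real (s - t) * w" by (simp add: f_def pu algebra_simps)
    then have "q = of_real (s - t)" using w by simp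
    then show "Im q = 0" by simp
  next
    assume "Im q = 0"
    then have q: "q = of_real (Re q)" by (simp add: complex_eq_iff)
    then have "\<bar>Re q\<bar> < r" using that abs_Re_le_cmod [of q] by linarith
    then have "0 \<le> t + Re q" "t + Re q \<le> 1" using r by linarith+
    moreover have "f q = (1 - (t + Re q)) *\<^sub>R u + (t + Re q) *\<^sub>R v"
      by (subst q) (simp add: f_def pu w_def algebra_simps scaleR_conv_of_real)
    ultimately show "f q \<in> closed_segment u v" unfolding in_segment by blast
  qed
  define H1 H2 where "H1 = f ` (ball 0 r \<inter> {q. Im q > 0})" and "H2 = f ` (ball 0 r \<inter> {q. Im q < 0})"
  show thesis
  proof
    show "connected H1" "connected H2"
      unfolding H1_def H2_def f_def
      by (intro connected_continuous_image convex_connected convex_Int convex_ball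
          convex_halfspace_Im_gt convex_halfspace_Im_lt continuous_intros)+
    have "f (Complex 0 (r/2)) \<in> H1" "f (Complex 0 (- (r/2))) \<in> H2"
      using r by (auto simp: H1_def H2_def cmod_def)
    then show "H1 \<noteq> {}" "H2 \<noteq> {}" by blast+
    show "open (ball p (r * norm w))" "p \<in> ball p (r * norm w)" using r w by auto
    show "ball p (r * norm w) \<subseteq> H1 \<union> H2 \<union> closed_segment u v"
    proof
      fix z assume z: "z \<in> ball p (r * norm w)"
      define q where "q = (z - p) / w"
      have q: "norm q < r" using z w by (simp add: q_def norm_divide dist_norm norm_minus_commute divide_simps)
      have "z = f q" using w by (simp add: q_def f_def)
      then show "z \<in> H1 \<union> H2 \<union> closed_segment u v"
        using q seg [OF q] unfolding H1_def H2_def by (cases "Im q" "0::real" rule: linorder_cases) auto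
    qed
    show "(H1 \<union> H2) \<inter> (closed_segment u v \<union> K) = {}"
      using seg inK unfolding H1_def H2_def by fastforce
  qed
qed

text \<open>
  A set without boundary points on a side of the segment contains that side or misses it. Each of
  the three sets comes arbitrarily close to \<open>p\<close> and so contains one of the two sides; two of them
  then contain the same one. The set \<open>K\<close> carries those parts of the boundaries that stay away from
  \<open>p\<close>. Every decision below about which region lies on which side of a curve rests on this pigeonhole
  argument.
\<close>

lemma no_three_regions_at_segment:
  fixes p u v :: complex
  assumes p: "p \<in> open_segment u v" and K: "closed K" "p \<notin> K"
    and W: "\<And>W. W \<in> {W1, W2, W3} \<Longrightarrow> p \<in> closure W \<and>
      frontier W \<subseteq> closed_segment u v \<union> K \<and> W \<inter> closed_segment u v = {}"
    and disj: "W1 \<inter> W2 = {}" "W1 \<inter> W3 = {}" "W2 \<inter> W3 = {}"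
  shows False
proof -
  obtain H1 H2 N where H: "connected H1" "connected H2" "H1 \<noteq> {}" "H2 \<noteq> {}" and N: "open N" "p \<in> N"
    "N \<subseteq> H1 \<union> H2 \<union> closed_segment u v" and HK: "(H1 \<union> H2) \<inter> (closed_segment u v \<union> K) = {}"
    by (rule segment_two_sides [OF p K])
  have side: "H1 \<subseteq> W \<or> H2 \<subseteq> W" if "W \<in> {W1, W2, W3}" for W
  proof -
    have W: "p \<in> closure W" "frontier W \<subseteq> closed_segment u v \<union> K" "W \<inter> closed_segment u v = {}"
      using W [OF that] by auto
    have "N \<inter> closure W \<noteq> {}" using N(2) W(1) by blast
    then have "N \<inter> W \<noteq> {}" using N(1) by (simp add: open_Int_closure_eq_empty)
    then have "H1 \<inter> W \<noteq> {} \<or> H2 \<inter> W \<noteq> {}" using N(3) W(3) by blast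
    moreover have "H1 \<inter> frontier W = {}" "H2 \<inter> frontier W = {}" using HK W(2) by blast+
    ultimately show ?thesis
      using connected_misses_frontier_subset H(1,2) by metis
  qed
  have "H1 \<subseteq> W1 \<or> H2 \<subseteq> W1" "H1 \<subseteq> W2 \<or> H2 \<subseteq> W2" "H1 \<subseteq> W3 \<or> H2 \<subseteq> W3"
    using side by simp_all
  with disj H(3,4) show False by blast
qed

section \<open>Theta curves\<close>

text \<open>
  Of the three arcs of a theta curve, one lies inside the cycle formed by the others, and an arc
  \<open>\<beta>\<close> that touches the unbounded region is not that one. Otherwise the insides of \<open>\<alpha> \<union> \<beta>\<close> and of
  \<open>\<alpha>' \<union> \<beta>\<close> would be regions of the complement of the theta curve. They are different regions because their
  boundaries differ, and together with the unbounded region they would meet at a point of \<open>\<beta>\<close>,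
  which has only two sides. The set \<open>S\<close> may contain further curves besides the theta curve; this
  makes the condition on \<open>p\<close> stronger.
\<close>

lemma theta_third_arc_inside:
  fixes \<alpha> \<alpha>' \<beta> :: "real \<Rightarrow> complex"
  assumes arcs: "arc \<alpha>" "arc \<alpha>'" "arc \<beta>"
    and ends: "pathstart \<alpha> = a" "pathfinish \<alpha> = b" "pathstart \<alpha>' = a" "pathfinish \<alpha>' = b"
      "pathstart \<beta> = a" "pathfinish \<beta> = b"
    and meet: "path_image \<alpha> \<inter> path_image \<alpha>' = {a, b}" "path_image \<alpha> \<inter> path_image \<beta> = {a, b}"
      "path_image \<alpha>' \<inter> path_image \<beta> = {a, b}"
    and p: "p \<in> path_image \<beta>" "p \<in> open_segment u v" "closed K" "p \<notin> K"
    and seg: "closed_segment u v \<subseteq> path_image \<beta>"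
    and cover: "path_image \<alpha> \<union> path_image \<alpha>' \<union> path_image \<beta> \<subseteq> S" "S \<subseteq> closed_segment u v \<union> K"
    and outer: "p \<in> frontier (outside S)" "closed S"
  shows "path_image \<alpha>' \<inter> inside (path_image \<alpha> \<union> path_image \<beta>) \<noteq> {} \<or>
         path_image \<alpha> \<inter> inside (path_image \<alpha>' \<union> path_image \<beta>) \<noteq> {}"
proof (rule ccontr)
  let ?A = "path_image \<alpha>" and ?A' = "path_image \<alpha>'" and ?B = "path_image \<beta>"
  assume "\<not> ?thesis"
  then have no: "?A' \<inter> inside (?A \<union> ?B) = {}" "?A \<inter> inside (?A' \<union> ?B) = {}" by auto
  have sp: "simple_path (\<alpha> +++ reversepath \<beta>)" "simple_path (\<alpha>' +++ reversepath \<beta>)"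
    using arcs ends meet by (auto intro!: simple_path_join_loop simp: arc_reversepath)
  have im: "path_image (\<alpha> +++ reversepath \<beta>) = ?A \<union> ?B" "path_image (\<alpha>' +++ reversepath \<beta>) = ?A' \<union> ?B"
    using ends by (auto simp: path_image_join)
  note J = inside_closed_path [OF sp(1), unfolded im] and J' = inside_closed_path [OF sp(2), unfolded im]
  have J: "connected (inside (?A \<union> ?B))" "frontier (inside (?A \<union> ?B)) = ?A \<union> ?B"
      "closure (inside (?A \<union> ?B)) = inside (?A \<union> ?B) \<union> (?A \<union> ?B)"
    and J': "connected (inside (?A' \<union> ?B))" "frontier (inside (?A' \<union> ?B)) = ?A' \<union> ?B"
      "closure (inside (?A' \<union> ?B)) = inside (?A' \<union> ?B) \<union> (?A' \<union> ?B)"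
    using J J' ends by auto
  have noB: "?B \<inter> inside (?A \<union> ?B) = {}" "?B \<inter> inside (?A' \<union> ?B) = {}"
    "?A \<inter> inside (?A \<union> ?B) = {}" "?A' \<inter> inside (?A' \<union> ?B) = {}"
    using inside_no_overlap [of "?A \<union> ?B"] inside_no_overlap [of "?A' \<union> ?B"] by blast+
  have none: "inside (?A \<union> ?B) \<inter> inside (?A' \<union> ?B) = {}"
  proof (rule ccontr)
    assume ne: "inside (?A \<union> ?B) \<inter> inside (?A' \<union> ?B) \<noteq> {}"
    \<comment> \<open>two regions of the same complement that meet are equal\<close>
    have "inside (?A \<union> ?B) \<subseteq> inside (?A' \<union> ?B)"
      using J J' ne no noB by (intro connected_misses_frontier_subset) auto
    moreover have "inside (?A' \<union> ?B) \<subseteq> inside (?A \<union> ?B)"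
      using J J' ne no noB by (intro connected_misses_frontier_subset) auto
    ultimately have "?A \<union> ?B = ?A' \<union> ?B" using J(2) J'(2) by (metis subset_antisym)
    then have "?A \<subseteq> {a, b}" using meet by blast
    then have "finite ?A" using finite_subset by blast
    moreover have "connected ?A" using arcs(1) by (simp add: connected_arc_image)
    ultimately obtain x where "?A = {x}" using meet(1) connected_finite_iff_sing by blast
    moreover have "a \<noteq> b" using arcs(1) ends arc_distinct_ends by metis
    moreover have "a \<in> ?A" "b \<in> ?A" using meet(1) by blast+
    ultimately show False by simp
  qed
  have oS: "inside (?A \<union> ?B) \<inter> outside S = {}" "inside (?A' \<union> ?B) \<inter> outside S = {}"
    using cover(1) outside_mono [of "?A \<union> ?B" S] outside_mono [of "?A' \<union> ?B" S]
      inside_Int_outside [of "?A \<union> ?B"] inside_Int_outside [of "?A' \<union> ?B"] by blast+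
  have regions: "p \<in> closure W \<and> frontier W \<subseteq> closed_segment u v \<union> K \<and> W \<inter> closed_segment u v = {}"
    if "W \<in> {inside (?A \<union> ?B), inside (?A' \<union> ?B), outside S}" for W
  proof -
    have "p \<in> closure W" using that J(3) J'(3) p(1) outer(1) by (auto simp: frontier_def)
    moreover have "frontier W \<subseteq> S"
      using that J(2) J'(2) cover(1) frontier_outside_subset [OF outer(2)] by auto
    moreover have "outside S \<inter> ?B = {}" using cover(1) outside_no_overlap [of S] by blast
    then have "W \<inter> ?B = {}" using that noB by auto
    ultimately show ?thesis using seg cover(2) by blast
  qed
  show False
    by (rule no_three_regions_at_segment [OF p(2-4) regions none oS])
qed

text \<open>
  The arc \<open>\<alpha>'\<close> cuts the inside of \<open>\<alpha> \<union> \<beta>\<close> into the insides of \<open>\<alpha> \<union> \<alpha>'\<close> and of \<open>\<beta> \<union> \<alpha>'\<close>. At \<open>p\<close> one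
  side of \<open>\<beta>\<close> is exterior to everything, so the other side belongs both to the inside of \<open>\<alpha> \<union> \<beta>\<close>
  and to that of \<open>\<delta>\<close>. The inside of \<open>\<delta>\<close>, being connected and disjoint from
  \<open>\<alpha> \<union> \<alpha>'\<close> and its inside, is therefore confined to the inside of \<open>\<beta> \<union> \<alpha>'\<close>. This separates \<open>\<delta>\<close> from \<open>\<alpha>\<close> except at
  the common ends, which is what makes \<open>\<alpha>\<close> a bridge.
\<close>

lemma theta_outer_cycle:
  fixes \<alpha> \<alpha>' \<beta> \<delta> :: "real \<Rightarrow> complex"
  assumes arcs: "arc \<alpha>" "arc \<alpha>'" "arc \<beta>"
    and ends: "pathstart \<alpha> = a" "pathfinish \<alpha> = b" "pathstart \<alpha>' = a" "pathfinish \<alpha>' = b"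
      "pathstart \<beta> = a" "pathfinish \<beta> = b"
    and meet: "path_image \<alpha> \<inter> path_image \<alpha>' = {a, b}" "path_image \<alpha> \<inter> path_image \<beta> = {a, b}"
      "path_image \<alpha>' \<inter> path_image \<beta> = {a, b}"
    and \<delta>: "simple_path \<delta>" "pathfinish \<delta> = pathstart \<delta>" "path_image \<beta> \<subseteq> path_image \<delta>"
    and S: "S = path_image \<alpha> \<union> path_image \<alpha>' \<union> path_image \<delta>"
    and disj: "inside (path_image \<alpha> \<union> path_image \<alpha>') \<inter> inside (path_image \<delta>) = {}"
      "inside (path_image \<delta>) \<inter> (path_image \<alpha> \<union> path_image \<alpha>') = {}"
    and p: "p \<in> path_image \<beta>" "p \<in> open_segment u v" "closed K" "p \<notin> K"
    and seg: "closed_segment u v \<subseteq> path_image \<beta>"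
    and cover: "S \<subseteq> closed_segment u v \<union> K"
    and outer: "p \<in> frontier (outside S)"
    and third: "path_image \<alpha>' \<inter> inside (path_image \<alpha> \<union> path_image \<beta>) \<noteq> {}"
  shows "inside (path_image \<alpha> \<union> path_image \<alpha>') \<subseteq> inside (path_image \<alpha> \<union> path_image \<beta>)"
    and "inside (path_image \<delta>) \<subseteq> inside (path_image \<alpha> \<union> path_image \<beta>)"
    and "path_image \<alpha> - {a, b} \<subseteq> outside (path_image \<delta>)"
proof -
  let ?A = "path_image \<alpha>" and ?A' = "path_image \<alpha>'" and ?B = "path_image \<beta>" and ?D = "path_image \<delta>"
  have "a \<noteq> b" using arcs(1) ends arc_distinct_ends by metis
  then have split:
    "inside (?A \<union> ?A') \<union> inside (?B \<union> ?A') \<union> (?A' - {a, b}) = inside (?A \<union> ?B)"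
    using split_inside_simple_closed_curve [of \<alpha> a b \<beta> \<alpha>'] arcs ends meet third
    by (auto simp: arc_imp_simple_path Int_commute)
  have parts: "inside (?A \<union> ?A') \<subseteq> inside (?A \<union> ?B)" "inside (?B \<union> ?A') \<subseteq> inside (?A \<union> ?B)"
    "inside (?A \<union> ?B) \<subseteq> inside (?A \<union> ?A') \<union> inside (?B \<union> ?A') \<union> ?A'"
    unfolding split [symmetric] by auto
  show "inside (?A \<union> ?A') \<subseteq> inside (?A \<union> ?B)" by (rule parts(1))
  have sp: "simple_path (\<alpha> +++ reversepath \<beta>)" "simple_path (\<beta> +++ reversepath \<alpha>')"
    using arcs ends meet by (auto intro!: simple_path_join_loop simp: arc_reversepath)
  have im: "path_image (\<alpha> +++ reversepath \<beta>) = ?A \<union> ?B" "path_image (\<beta> +++ reversepath \<alpha>') = ?B \<union> ?A'"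
    using ends by (auto simp: path_image_join)
  have J: "connected (inside (?A \<union> ?B))" "frontier (inside (?A \<union> ?B)) = ?A \<union> ?B"
      "closure (inside (?A \<union> ?B)) = inside (?A \<union> ?B) \<union> (?A \<union> ?B)"
    and J': "closure (inside (?B \<union> ?A')) = inside (?B \<union> ?A') \<union> (?B \<union> ?A')"
    using inside_closed_path [OF sp(1)] inside_closed_path [OF sp(2)] ends unfolding im by auto
  note D = inside_closed_path [OF \<delta>(1,2)]
  have noD: "inside ?D \<inter> ?D = {}" "inside (?A \<union> ?B) \<inter> (?A \<union> ?B) = {}" "outside S \<inter> S = {}"
    using inside_no_overlap outside_no_overlap by blast+
  have "closed S" unfolding S using arcs \<delta>
    by (intro closed_Un closed_arc_image closed_simple_path_image) auto
  have oS: "inside ?D \<inter> outside S = {}" "inside (?A \<union> ?B) \<inter> outside S = {}"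
    using S \<delta>(3) outside_mono [of ?D S] outside_mono [of "?A \<union> ?B" S]
      inside_Int_outside [of ?D] inside_Int_outside [of "?A \<union> ?B"] by blast+
  have "inside ?D \<inter> inside (?A \<union> ?B) \<noteq> {}"
  proof
    assume none: "inside ?D \<inter> inside (?A \<union> ?B) = {}"
    have regions: "p \<in> closure W \<and> frontier W \<subseteq> closed_segment u v \<union> K \<and> W \<inter> closed_segment u v = {}"
      if "W \<in> {inside ?D, inside (?A \<union> ?B), outside S}" for W
    proof -
      have "p \<in> closure W" using that J(3) D(6) p(1) \<delta>(3) outer by (auto simp: frontier_def)
      moreover have "frontier W \<subseteq> S"
        using that J(2) D(4) S \<delta>(3) frontier_outside_subset [OF \<open>closed S\<close>] by auto
      moreover have "W \<inter> ?B = {}" using that noD S \<delta>(3) by blast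
      ultimately show ?thesis using seg cover by blast
    qed
    show False
      by (rule no_three_regions_at_segment [OF p(2-4) regions none oS])
  qed
  moreover have "inside ?D \<inter> frontier (inside (?A \<union> ?B)) = {}"
    using disj(2) noD \<delta>(3) J(2) by blast
  ultimately have "inside ?D \<subseteq> inside (?A \<union> ?B)"
    using D(3) by (intro connected_misses_frontier_subset)
  then show "inside ?D \<subseteq> inside (?A \<union> ?B)" .
  then have *: "inside ?D \<subseteq> inside (?B \<union> ?A')"
    using parts(3) disj by blast
  then have "closure (inside ?D) \<subseteq> inside (?B \<union> ?A') \<union> (?B \<union> ?A')"
    using closure_mono J' by metis
  then have "inside ?D \<union> ?D \<subseteq> inside (?B \<union> ?A') \<union> (?B \<union> ?A')" unfolding D(6) .
  moreover have "?A \<inter> inside (?B \<union> ?A') = {}" using parts(2) noD(2) by blast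
  moreover have "?A \<inter> (?B \<union> ?A') = {a, b}" using meet(1,2) by (simp add: Int_Un_distrib)
  ultimately have "?A \<inter> (inside ?D \<union> ?D) \<subseteq> {a, b}" by blast
  then show "?A - {a, b} \<subseteq> outside ?D"
    using inside_Un_outside [of ?D] by blast
qed

section \<open>The outer boundary of two cycles\<close>

text \<open>
  Every point of \<open>curve D\<close> is a limit of interior points of \<open>D\<close>, and the interior of \<open>C\<close> is open.
\<close>

lemma disjoint_interiors_curve:
  assumes "lattice_cycle C" "lattice_cycle D" "cycle_interior C \<inter> cycle_interior D = {}"
  shows "inside (curve C) \<inter> curve D = {}"
proof -
  have "inside (curve C) \<inter> closure (inside (curve D)) = {}"
    using assms inside_lattice_cycle(2)
    by (simp add: cycle_interior_def open_Int_closure_eq_empty)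
  then show ?thesis using inside_lattice_cycle(6) [OF assms(2)] by blast
qed

lemma lattice_edge_interior_point:
  assumes "e \<in> lattice_edges" "p \<in> convex hull e" "p \<notin> e" "F \<subseteq> lattice_edges" "finite F"
  obtains u v where "convex hull e = closed_segment u v" "p \<in> open_segment u v"
    "closed (curve (F - {e}))" "p \<notin> curve (F - {e})"
proof -
  obtain u v where "e = {u, v}" "convex hull e = closed_segment u v"
    using assms(1) lattice_edge_segment by blast
  moreover from this have "p \<in> open_segment u v" using assms by (auto simp: open_segment_def)
  moreover have "closed (curve (F - {e}))" using assms by (intro closed_curve) auto
  moreover have "p \<notin> curve (F - {e})"
    using assms lattice_edges_meet(1) unfolding curve_def by blast
  ultimately show thesis using that by blast
qed

text \<open>
  If the unbounded region of the union had its boundary on \<open>curve C\<close> and finitely many points, then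
  it would fill the exterior of \<open>C\<close> up to these points, since deleting finitely many points does not
  disconnect the exterior. There would be no room left for the interior of \<open>D\<close>.
\<close>

lemma outer_boundary_point:
  assumes C: "lattice_cycle C" and D: "lattice_cycle D"
    and disj: "cycle_interior C \<inter> cycle_interior D = {}"
  obtains e p where "e \<in> D" "p \<in> convex hull e" "p \<notin> e" "p \<notin> curve C"
    "p \<in> frontier (outside (curve (C \<union> D)))"
proof (rule ccontr)
  assume none: "\<not> thesis"
  let ?U = "outside (curve (C \<union> D))"
  have fin: "finite (C \<union> D)" "C \<union> D \<subseteq> lattice_edges" "finite (\<Union>D)"
    using C D lattice_cycle_edges by (auto elim!: lattice_edge_segment)
  have "frontier ?U \<subseteq> curve C \<union> \<Union>D"
  proof
    fix p assume p: "p \<in> frontier ?U"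
    then have "p \<in> curve (C \<union> D)" using frontier_outside_subset closed_curve fin by blast
    then have "p \<in> curve C \<or> (\<exists>e\<in>D. p \<in> convex hull e)" by (auto simp: curve_def)
    then show "p \<in> curve C \<union> \<Union>D" using none that p by blast
  qed
  then have fr: "(outside (curve C) - \<Union>D) \<inter> frontier ?U = {}" using outside_no_overlap by blast
  have bd: "bounded (curve C)" "bounded (curve (C \<union> D))" "closed (curve C)"
    using fin by (auto intro!: bounded_curve closed_curve)
  have "connected (outside (curve C) - \<Union>D)"
    using bd fin by (intro connected_open_delete_finite open_outside connected_outside) auto
  moreover have "(outside (curve C) - \<Union>D) \<inter> ?U \<noteq> {}"
  proof -
    have "?U \<noteq> {}" using bd unbounded_outside by fastforce
    moreover have "?U \<subseteq> outside (curve C)" by (intro outside_mono curve_mono) auto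
    moreover have "\<Union>D \<subseteq> curve (C \<union> D)"
      using vertices_subset_curve [of D] curve_mono [of D "C \<union> D"] by blast
    then have "?U \<inter> \<Union>D = {}" using outside_no_overlap [of "curve (C \<union> D)"] by blast
    ultimately show ?thesis by blast
  qed
  ultimately have "outside (curve C) - \<Union>D \<subseteq> ?U"
    using fr by (intro connected_misses_frontier_subset)
  moreover have "inside (curve D) \<subseteq> outside (curve C)"
    using disj disjoint_interiors_curve [OF D C] inside_Un_outside [of "curve C"]
    unfolding cycle_interior_def by blast
  moreover have "inside (curve D) \<inter> \<Union>D = {}"
    using vertices_subset_curve [of D] inside_no_overlap [of "curve D"] by blast
  moreover have "?U \<inter> inside (curve D) = {}"
    using outside_mono [of "curve D" "curve (C \<union> D)"] curve_mono [of D "C \<union> D"]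
      inside_Int_outside [of "curve D"] by blast
  ultimately show False using inside_lattice_cycle(1) [OF D] by blast
qed

text \<open>
  The bridge of \<open>D\<close> through an edge on the outer boundary and the two paths into which its ends cut
  \<open>C\<close> form a theta curve. The path of \<open>C\<close> that is not enclosed completes the bridge to the required
  cycle.
\<close>

lemma enclosing_cycle_exists:
  assumes C: "lattice_cycle C" and D: "lattice_cycle D"
    and disj: "cycle_interior C \<inter> cycle_interior D = {}"
    and common: "card (\<Union>C \<inter> \<Union>D) > 1"
  shows "\<exists>P1 P2. lattice_cycle (P1 \<union> P2) \<and> bridge P1 D C \<and> bridge P2 C D \<and>
           cycle_interior C \<subseteq> cycle_interior (P1 \<union> P2) \<and> cycle_interior D \<subseteq> cycle_interior (P1 \<union> P2)"
proof -
  have CD: "C \<subseteq> lattice_edges" "D \<subseteq> lattice_edges" "finite C" "finite D"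
    using C D lattice_cycle_edges by auto
  have iC: "inside (curve C) \<inter> curve D = {}" and iD: "inside (curve D) \<inter> curve C = {}"
    using disjoint_interiors_curve C D disj by (auto simp: Int_commute)
  obtain e p where e: "e \<in> D" "p \<in> convex hull e" "p \<notin> e" and pC: "p \<notin> curve C"
    and outer: "p \<in> frontier (outside (curve (C \<union> D)))"
    using outer_boundary_point [OF C D disj] by blast
  define K where "K = curve (C \<union> D - {e})"
  obtain u v where uv: "convex hull e = closed_segment u v" "p \<in> open_segment u v" "closed K" "p \<notin> K"
    using lattice_edge_interior_point [of e p "C \<union> D"] e CD unfolding K_def by blast
  have cover: "curve (C \<union> D) \<subseteq> closed_segment u v \<union> K"
    unfolding K_def curve_def using uv by auto
  have "\<not> (\<exists>x. \<Union>C \<inter> \<Union>D \<subseteq> {x})"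
    using common card_mono [of "{x}" "\<Union>C \<inter> \<Union>D" for x] by fastforce
  then obtain x y where xy: "x \<in> \<Union>C \<inter> \<Union>D" "y \<in> \<Union>C \<inter> \<Union>D" "x \<noteq> y" by blast
  obtain B a b where B0: "lattice_path B" "hd B = a" "last B = b" "e \<in> edges_of B" "edges_of B \<subseteq> D"
    "set B \<inter> \<Union>C = {a, b}"
    by (rule lattice_cycle_path_through_edge [OF D e(1) xy])
  note B = B0(1,4,5,6)
  have "a \<noteq> b" using hd_noteq_last [OF B0(1)] B0(2,3) by simp
  moreover have "{a, b} \<subseteq> \<Union>C" using B(4) by (metis Int_lower2)
  ultimately have ab: "a \<noteq> b" "a \<in> \<Union>C" "b \<in> \<Union>C" by simp_all
  obtain P Q where PQ: "lattice_path P" "lattice_path Q" "hd P = a" "last P = b" "hd Q = a" "last Q = b"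
    "C = edges_of P \<union> edges_of Q" "edges_of P \<inter> edges_of Q = {}" "set P \<inter> set Q = {a, b}"
    by (rule lattice_cycle_two_paths [OF C ab(2,3,1)])
  have V: "\<Union>(edges_of B) = set B" "\<Union>(edges_of P) = set P" "\<Union>(edges_of Q) = set Q" "\<Union>C = set P \<union> set Q"
    using B PQ vertices_lattice_path by auto
  have ends: "{a, b} \<subseteq> set B" "{a, b} \<subseteq> set P" "{a, b} \<subseteq> set Q"
    using B(4) PQ(9) by blast+
  \<comment> \<open>a common edge would have both ends in \<open>{a, b}\<close>, so it would be all of \<open>B\<close>, that is, \<open>e\<close>\<close>
  have BC: "edges_of B \<inter> C = {}"
  proof (rule ccontr)
    assume "edges_of B \<inter> C \<noteq> {}"
    then obtain f where f: "f \<in> edges_of B" "f \<in> C" by blast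
    then have "f \<subseteq> {a, b}" using V B(4) by blast
    moreover have "f \<in> lattice_edges" using f CD by blast
    ultimately have fab: "f = {a, b}" by (auto elim!: lattice_edge_segment)
    obtain zs where zs: "B = a # zs @ [b]" using lattice_path_shape B0(1,2,3) by metis
    then have "zs = []"
      using edge_joining_ends [of a zs b] f fab B(1) unfolding lattice_path_def
      by (metis insert_commute)
    then have "edges_of B = {{a, b}}" using zs by (metis append_Nil edges_of_simps(2,3))
    then have "e = f" using B(2) fab by simp
    then have "p \<in> curve C" using f(2) e(2) unfolding curve_def by blast
    then show False using pC by simp
  qed
  then have BPQ: "edges_of B \<inter> edges_of P = {}" "edges_of B \<inter> edges_of Q = {}" using PQ(7) by auto
  have sub: "edges_of B \<subseteq> lattice_edges" "edges_of P \<subseteq> lattice_edges" "edges_of Q \<subseteq> lattice_edges"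
    using B(1) PQ(1,2) unfolding lattice_path_def by auto
  have "set P \<inter> set B \<subseteq> {a, b}" "set Q \<inter> set B \<subseteq> {a, b}" using B(4) V(4) by blast+
  then have BP: "set P \<inter> set B = {a, b}" and BQ: "set Q \<inter> set B = {a, b}"
    using ends by (simp_all add: subset_antisym)
  have meet: "curve (edges_of P) \<inter> curve (edges_of Q) = {a, b}"
    "curve (edges_of P) \<inter> curve (edges_of B) = {a, b}"
    "curve (edges_of Q) \<inter> curve (edges_of B) = {a, b}"
    using BPQ PQ(8,9) sub V BP BQ curve_Int by (auto simp: Int_commute)
  obtain \<beta> where \<beta>: "arc \<beta>" "pathstart \<beta> = a" "pathfinish \<beta> = b" "path_image \<beta> = curve (edges_of B)"
    using arc_lattice_path [OF B(1)] B0(2,3) by metis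
  obtain \<alpha> where \<alpha>: "arc \<alpha>" "pathstart \<alpha> = a" "pathfinish \<alpha> = b" "path_image \<alpha> = curve (edges_of P)"
    using arc_lattice_path [OF PQ(1)] PQ by metis
  obtain \<alpha>' where \<alpha>': "arc \<alpha>'" "pathstart \<alpha>' = a" "pathfinish \<alpha>' = b" "path_image \<alpha>' = curve (edges_of Q)"
    using arc_lattice_path [OF PQ(2)] PQ by metis
  obtain \<delta> where \<delta>: "simple_path \<delta>" "pathfinish \<delta> = pathstart \<delta>" "path_image \<delta> = curve D"
    using simple_closed_path_lattice_cycle [OF D] by blast
  have seg: "closed_segment u v \<subseteq> curve (edges_of B)" using B(2) uv(1) unfolding curve_def by blast
  have pB: "p \<in> curve (edges_of B)" using B(2) e(2) unfolding curve_def by blast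
  have BD: "curve (edges_of B) \<subseteq> curve D" using B(3) by (rule curve_mono)
  have cC: "curve C = curve (edges_of P) \<union> curve (edges_of Q)" using PQ(7) curve_Un by blast
  have disj': "inside (curve C) \<inter> inside (curve D) = {}" using disj by (simp add: cycle_interior_def)

  have bridgeB: "bridge (edges_of B) D C"
  proof -
    have "x \<in> cycle_exterior C" if "x \<in> set B - {a, b}" for x
    proof -
      have "x \<in> \<Union>D" "x \<notin> \<Union>C" using that B(3,4) V(1) by blast+
      then have "x \<in> curve D" "x \<notin> curve C"
        using vertices_subset_curve [of D] curve_vertex CD by blast+
      then show ?thesis using iC inside_Un_outside [of "curve C"] unfolding cycle_exterior_def by blast
    qed
    then show ?thesis unfolding bridge_def using B0(1,2,3) B(3) ab by blast
  qed
  have bridge: "bridge (edges_of R) C D"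
    if R: "lattice_path R" "hd R = a" "last R = b" "edges_of R \<subseteq> C"
      and ext: "curve (edges_of R) - {a, b} \<subseteq> outside (curve D)" for R
  proof -
    have "set R \<subseteq> curve (edges_of R)" using vertices_subset_curve vertices_lattice_path R(1) by blast
    moreover have "a \<in> \<Union>D" "b \<in> \<Union>D" using ends(1) V(1) B(3) by blast+
    ultimately show ?thesis unfolding bridge_def cycle_exterior_def using R ext by blast
  qed
  consider "curve (edges_of Q) \<inter> inside (curve (edges_of P) \<union> curve (edges_of B)) \<noteq> {}"
    | "curve (edges_of P) \<inter> inside (curve (edges_of Q) \<union> curve (edges_of B)) \<noteq> {}"
  proof -
    have 1: "path_image \<alpha> \<union> path_image \<alpha>' \<union> path_image \<beta> \<subseteq> curve (C \<union> D)"
      using BD cC unfolding \<alpha>(4) \<alpha>'(4) \<beta>(4) by (auto simp: curve_Un)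
    have 2: "closed (curve (C \<union> D))" using CD by (intro closed_curve) auto
    show thesis
      using theta_third_arc_inside [OF \<alpha>(1) \<alpha>'(1) \<beta>(1) \<alpha>(2,3) \<alpha>'(2,3) \<beta>(2,3)
          meet [folded \<alpha>(4) \<alpha>'(4) \<beta>(4)] pB [folded \<beta>(4)] uv(2-4) seg [folded \<beta>(4)] 1 cover outer 2]
        that unfolding \<alpha>(4) \<alpha>'(4) \<beta>(4) by blast
  qed
  then show ?thesis
  proof cases
    case 1
    note T = theta_outer_cycle [where S = "curve (C \<union> D)", OF \<alpha>(1) \<alpha>'(1) \<beta>(1) \<alpha>(2,3) \<alpha>'(2,3) \<beta>(2,3)
          _ _ _ \<delta>(1,2) _ _ _ _ _ uv(2-4) _ cover outer, unfolded \<alpha>(4) \<alpha>'(4) \<beta>(4) \<delta>(3),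
          OF meet BD _ _ _ pB seg 1]
    have "curve (C \<union> D) = curve (edges_of P) \<union> curve (edges_of Q) \<union> curve D"
      using cC by (simp add: curve_Un)
    note T = T [OF this, folded cC, OF disj' iD]
    have "bridge (edges_of P) C D" using T(3) PQ by (intro bridge) auto
    moreover have "lattice_cycle (edges_of B \<union> edges_of P)"
      using B0(1-3) PQ BP BPQ by (intro lattice_cycle_of_two_paths [of B a b P]) auto
    ultimately show ?thesis
      using bridgeB T(1,2) unfolding cycle_interior_def
      by (intro exI [of _ "edges_of B"] exI [of _ "edges_of P"]) (simp add: curve_Un Un_commute)
  next
    case 2
    have meet': "curve (edges_of Q) \<inter> curve (edges_of P) = {a, b}" using meet by blast
    note T = theta_outer_cycle [where S = "curve (C \<union> D)", OF \<alpha>'(1) \<alpha>(1) \<beta>(1) \<alpha>'(2,3) \<alpha>(2,3) \<beta>(2,3)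
          _ _ _ \<delta>(1,2) _ _ _ _ _ uv(2-4) _ cover outer, unfolded \<alpha>(4) \<alpha>'(4) \<beta>(4) \<delta>(3),
          OF meet' meet(3,2) BD _ _ _ pB seg 2]
    have cC': "curve C = curve (edges_of Q) \<union> curve (edges_of P)" using cC by blast
    then have "curve (C \<union> D) = curve (edges_of Q) \<union> curve (edges_of P) \<union> curve D"
      by (simp add: curve_Un)
    note T = T [OF this, folded cC', OF disj' iD]
    have "bridge (edges_of Q) C D" using T(3) PQ by (intro bridge) auto
    moreover have "lattice_cycle (edges_of B \<union> edges_of Q)"
      using B0(1-3) PQ BQ BPQ by (intro lattice_cycle_of_two_paths [of B a b Q]) auto
    ultimately show ?thesis
      using bridgeB T(1,2) unfolding cycle_interior_def
      by (intro exI [of _ "edges_of B"] exI [of _ "edges_of Q"]) (simp add: curve_Un Un_commute)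
  qed
qed

text \<open>
  The curves of \<open>C\<close> and \<open>D\<close> lie in the closures of their interiors, hence in the closure of the interior
  of \<open>E\<close>, so the exterior of \<open>E\<close> meets neither of them. Consequently \<open>curve E\<close> is determined by \<open>C\<close> and
  \<open>D\<close>, as the boundary of the unbounded region of their union.
\<close>

lemma outside_enclosing_cycle:
  assumes C: "lattice_cycle C" and D: "lattice_cycle D" and E: "lattice_cycle E" "E \<subseteq> C \<union> D"
    and enc: "cycle_interior C \<subseteq> cycle_interior E" "cycle_interior D \<subseteq> cycle_interior E"
  shows "outside (curve E) = outside (curve (C \<union> D))"
proof
  have "closure (inside (curve C)) \<union> closure (inside (curve D)) \<subseteq> closure (inside (curve E))"
    using enc closure_mono unfolding cycle_interior_def by blast
  then have "curve (C \<union> D) \<subseteq> inside (curve E) \<union> curve E"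
    unfolding curve_Un E(1) [THEN inside_lattice_cycle(6)] C [THEN inside_lattice_cycle(6)]
      D [THEN inside_lattice_cycle(6)] by blast
  then have "outside (curve E) \<inter> curve (C \<union> D) = {}"
    using inside_Int_outside [of "curve E"] outside_no_overlap [of "curve E"] by blast
  then have "curve (C \<union> D) \<inter> outside (curve E \<union> {}) = {}" by auto
  from outside_Un_outside_Un [OF this]
  have "outside (curve E) \<subseteq> outside (curve E \<union> curve (C \<union> D))" by simp
  also have "curve E \<union> curve (C \<union> D) = curve (C \<union> D)" using curve_mono [OF E(2)] by blast
  finally show "outside (curve E) \<subseteq> outside (curve (C \<union> D))" .
  show "outside (curve (C \<union> D)) \<subseteq> outside (curve E)"
    by (intro outside_mono curve_mono E(2))
qed

text \<open>
  At an edge common to \<open>C\<close> and \<open>D\<close>, the interiors of \<open>C\<close> and \<open>D\<close> occupy both sides and leave no side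
  for the exterior of \<open>E\<close>.
\<close>

lemma enclosing_cycle_avoids_common_edges:
  assumes C: "lattice_cycle C" and D: "lattice_cycle D" and E: "lattice_cycle E" "E \<subseteq> C \<union> D"
    and disj: "cycle_interior C \<inter> cycle_interior D = {}"
    and enc: "cycle_interior C \<subseteq> cycle_interior E" "cycle_interior D \<subseteq> cycle_interior E"
  shows "E \<inter> C \<inter> D = {}"
proof (rule ccontr)
  assume "E \<inter> C \<inter> D \<noteq> {}"
  then obtain e where e: "e \<in> E" "e \<in> C" "e \<in> D" by blast
  have CD: "C \<subseteq> lattice_edges" "D \<subseteq> lattice_edges" "finite C" "finite D"
    using C D lattice_cycle_edges by auto
  obtain u v where "e = {u, v}" "u \<noteq> v" "convex hull e = closed_segment u v"
    using e CD lattice_edge_segment by blast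
  then have m: "midpoint u v \<in> convex hull e" "midpoint u v \<notin> e" by (auto simp: midpoint_eq_endpoint)
  define p where "p = midpoint u v"
  obtain u v where uv: "convex hull e = closed_segment u v" "p \<in> open_segment u v"
    "closed (curve (C \<union> D - {e}))" "p \<notin> curve (C \<union> D - {e})"
    using lattice_edge_interior_point [of e p "C \<union> D"] e m CD unfolding p_def by blast
  have hull: "convex hull e \<subseteq> curve E" "convex hull e \<subseteq> curve C" "convex hull e \<subseteq> curve D"
    using e unfolding curve_def by blast+
  have pc: "p \<in> curve E" "p \<in> curve C" "p \<in> curve D" using hull m unfolding p_def by blast+
  have cover: "curve (C \<union> D) \<subseteq> closed_segment u v \<union> curve (C \<union> D - {e})"
    unfolding curve_def using uv by auto
  have sub: "curve C \<subseteq> curve (C \<union> D)" "curve D \<subseteq> curve (C \<union> D)" "curve E \<subseteq> curve (C \<union> D)"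
    using E(2) by (auto intro!: curve_mono)
  let ?W = "{inside (curve C), inside (curve D), outside (curve E)}"
  have regions: "p \<in> closure W \<and> frontier W \<subseteq> closed_segment u v \<union> curve (C \<union> D - {e}) \<and> W \<inter> closed_segment u v = {}"
    if "W \<in> ?W" for W
  proof -
    have "p \<in> frontier W"
      using that pc inside_lattice_cycle(4,5) C D E(1) by auto
    moreover have "frontier W \<subseteq> curve (C \<union> D)"
      using that sub inside_lattice_cycle(4,5) C D E(1) by auto
    moreover have "W \<inter> convex hull e = {}"
      using that hull inside_no_overlap outside_no_overlap by blast
    ultimately show ?thesis using cover uv(1) by (auto simp: frontier_def)
  qed
  have disjoint: "inside (curve C) \<inter> inside (curve D) = {}" "inside (curve C) \<inter> outside (curve E) = {}"
    "inside (curve D) \<inter> outside (curve E) = {}"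
    using disj enc inside_Int_outside [of "curve E"] unfolding cycle_interior_def by blast+
  show False
    by (rule no_three_regions_at_segment [OF uv(2-4) regions disjoint])
qed

theorem theorem6:
  fixes C D :: "complex set set"
  assumes "lattice_cycle C" and "lattice_cycle D"
    and "cycle_interior C \<inter> cycle_interior D = {}"
    and "card (\<Union>C \<inter> \<Union>D) > 1"
  shows "\<exists>!(E, P1, P2). lattice_cycle E \<and>
           E = P1 \<union> P2 \<and> bridge P1 D C \<and> bridge P2 C D \<and>
           cycle_interior C \<subseteq> cycle_interior E \<and> cycle_interior D \<subseteq> cycle_interior E"
proof -
  define good where "good E P1 P2 \<longleftrightarrow> lattice_cycle E \<and>
           E = P1 \<union> P2 \<and> bridge P1 D C \<and> bridge P2 C D \<and>
           cycle_interior C \<subseteq> cycle_interior E \<and> cycle_interior D \<subseteq> cycle_interior E" for E P1 P2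
  have facts: "curve E = frontier (outside (curve (C \<union> D)))" "E \<subseteq> lattice_edges"
    "P1 = E \<inter> D" "P2 = E \<inter> C" if "good E P1 P2" for E P1 P2
  proof -
    have g: "lattice_cycle E" "E = P1 \<union> P2" "P1 \<subseteq> D" "P2 \<subseteq> C"
      "cycle_interior C \<subseteq> cycle_interior E" "cycle_interior D \<subseteq> cycle_interior E"
      using that unfolding good_def bridge_def by auto
    then have sub: "E \<subseteq> C \<union> D" by blast
    show "curve E = frontier (outside (curve (C \<union> D)))"
      using outside_enclosing_cycle [OF assms(1,2) g(1) sub g(5,6)] inside_lattice_cycle(5) [OF g(1)] by simp
    show "E \<subseteq> lattice_edges" using g(1) lattice_cycle_edges by blast
    have "E \<inter> C \<inter> D = {}"
      by (rule enclosing_cycle_avoids_common_edges [OF assms(1,2) g(1) sub assms(3) g(5,6)])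
    then show "P1 = E \<inter> D" "P2 = E \<inter> C" using g(2-4) by blast+
  qed
  have unique: "E = E' \<and> P1 = P1' \<and> P2 = P2'" if "good E P1 P2" "good E' P1' P2'" for E P1 P2 E' P1' P2'
  proof -
    have "E = E'"
      using facts [OF that(1)] facts [OF that(2)] curve_subset_imp_subset by blast
    then show ?thesis using facts(3,4) that by metis
  qed
  obtain P1 P2 where P: "good (P1 \<union> P2) P1 P2"
    using enclosing_cycle_exists [OF assms] unfolding good_def by blast
  have "\<exists>!(E, P1, P2). good E P1 P2"
  proof (rule ex1I [of _ "(P1 \<union> P2, P1, P2)"])
    show "case (P1 \<union> P2, P1, P2) of (E, P1, P2) \<Rightarrow> good E P1 P2" using P by simp
    fix z assume "case z of (E, P1, P2) \<Rightarrow> good E P1 P2"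
    moreover obtain E Q1 Q2 where z: "z = (E, Q1, Q2)" by (cases z)
    ultimately have "good E Q1 Q2" by simp
    from unique [OF this P] show "z = (P1 \<union> P2, P1, P2)" unfolding z by simp
  qed
  then show ?thesis unfolding good_def .
qed

end
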